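(* In any finitary transition system $\mathcal{T}=(\mathrm{Proc},\mathsf{Act},\rightarrow,\uparrow)$, for all $p,q\in\mathrm{Proc}$: \[ p\lesssim^{B}q\iff p\lesssim_\omega q\iff p\lesssim^{F}q\iff\mathcal{L}_\omega(p)\subseteq\mathcal{L}_\omega(q). \]
   Context: A transition system is $(\mathrm{Proc},\mathsf{Act},\rightarrow,\uparrow)$ with ${\rightarrow}\subseteq\mathrm{Proc}\times\mathsf{Act}\times\mathrm{Proc}$ (written $p\xrightarrow{a}q$), ${\uparrow}\subseteq\mathrm{Proc}$; $p\downarrow$ means not $p\uparrow$. Relations $\lesssim_\alpha$: $\lesssim_0$ total; $p\lesssim_{\alpha+1}q$ iff for all $a$: (1) $p\xrightarrow{a}p'$ implies $\exists q'.\,q\xrightarrow{a}q'\wedge p'\lesssim_\alpha q'$; (2) $p\downarrow$ implies $q\downarrow$ and ($q\xrightarrow{a}q'$ implies $\exists p'.\,p\xrightarrow{a}p'\wedge p'\lesssim_\alpha q'$); at limits intersections; so $\lesssim_\omega=\bigcap_{n<\omega}\lesssim_n$. $\lesssim^B$ is the largest relation $R$ satisfying (1),(2) with $R$ in place of $\lesssim_\alpha$. Finite synchronisation trees $\mathsf{ST}_\omega$: terms $\sum_{i\in I}a_it_i$ and $\sum_{i\in I}a_it_i+\Omega$ ($I$ finite), with $t\uparrow$ iff $\Omega$ is a summand and $t\xrightarrow{a_i}t_i$ for each summand; $p\lesssim^Fq$ iff every $t\in\mathsf{ST}_\omega$ with $t\lesssim^Bp$ (in the disjoint union) satisfies $t\lesssim^Bq$.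 $\mathcal{L}_\infty$: sorts $\pi,\kappa$; set-indexed conjunctions/disjunctions within a sort; $a(\phi)$ of sort $\kappa$ for $\phi$ of sort $\pi$; $\Box\phi,\Diamond\phi$ of sort $\pi$ for $\phi$ of sort $\kappa$; $\mathcal{L}_\omega$ restricts to finite conjunctions/disjunctions. With $C(p)=\{\bot:p\uparrow\}\cup\{\langle a,q\rangle:p\xrightarrow{a}q\}$: $p\models\Box\phi$ iff all $c\in C(p)$ satisfy $\phi$; $p\models\Diamond\phi$ iff some $c\in C(p)\cup\{\bot\}$ satisfies $\phi$; $c\models a(\phi)$ iff $c=\langle a,q\rangle$ with $q\models\phi$. $\mathcal{L}_\omega(p)$ = sort-$\pi$ formulas of $\mathcal{L}_\omega$ satisfied by $p$. $\mathcal{T}\models\phi\le\psi$ means every element satisfying $\phi$ satisfies $\psi$. $\mathcal{T}$ is finitary if for every set $I$ and family $(\phi_i)_{i\in I}$ of sort-$\kappa$ formulas of $\mathcal{L}_\omega$, with $\mathsf{Fin}(I)$ the finite subsets of $I$: (BN) $\mathcal{T}\models\Box\bigvee_{i\in I}\phi_i\le\bigvee_{J\in\mathsf{Fin}(I)}\Box\bigvee_{j\in J}\phi_j$ and (FA) $\mathcal{T}\models\bigwedge_{J\in\mathsf{Fin}(I)}\Diamond\bigwedge_{j\in J}\phi_j\le\Diamond\bigwedge_{i\in I}\phi_i$. *)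

theory Defs
  imports Main
begin

record ('p, 'a) trans_sys =
  step :: "'p \<Rightarrow> 'a \<Rightarrow> 'p \<Rightarrow> bool"
  diverges :: "'p \<Rightarrow> bool"

definition pre_step ::
  "('p, 'a) trans_sys \<Rightarrow> ('p \<Rightarrow> 'p \<Rightarrow> bool) \<Rightarrow> 'p \<Rightarrow> 'p \<Rightarrow> bool" where
  "pre_step T R p q \<longleftrightarrow>
    (\<forall>a.
      (\<forall>p'. step T p a p' \<longrightarrow> (\<exists>q'. step T q a q' \<and> R p' q')) \<and>
      (\<not> diverges T p \<longrightarrow>
        \<not> diverges T q \<and>
        (\<forall>q'. step T q a q' \<longrightarrow> (\<exists>p'. step T p a p' \<and> R p' q'))))"

lemma mono_pre_step: "mono (pre_step T)"
  by (rule monoI, unfold le_fun_def le_bool_def pre_step_def) blast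

primrec pre_approx :: "('p, 'a) trans_sys \<Rightarrow> nat \<Rightarrow> 'p \<Rightarrow> 'p \<Rightarrow> bool" where
  "pre_approx T 0 = (\<lambda>p q. True)"
| "pre_approx T (Suc n) = pre_step T (pre_approx T n)"

definition pre_omega :: "('p, 'a) trans_sys \<Rightarrow> 'p \<Rightarrow> 'p \<Rightarrow> bool" where
  "pre_omega T p q \<longleftrightarrow> (\<forall>n. pre_approx T n p q)"

definition prebisim :: "('p, 'a) trans_sys \<Rightarrow> 'p \<Rightarrow> 'p \<Rightarrow> bool" where
  "prebisim T = gfp (pre_step T)"

lemma prebisim_largest:
  "prebisim T \<le> pre_step T (prebisim T)"
  "R \<le> pre_step T R \<Longrightarrow> R \<le> prebisim T"
  unfolding prebisim_def
  by (simp flip: gfp_unfold[OF mono_pre_step]) (rule gfp_upperbound)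


text \<open>
  In \<open>ST xs b\<close> the list \<open>xs\<close> is the finite family of summands
  \<open>a\<^sub>i t\<^sub>i\<close>, and \<open>b\<close> says whether \<open>\<Omega>\<close> is a summand.
\<close>

datatype 'a sync_tree = ST "('a \<times> 'a sync_tree) list" bool

fun tree_step :: "'a sync_tree \<Rightarrow> 'a \<Rightarrow> 'a sync_tree \<Rightarrow> bool" where
  "tree_step (ST xs b) a t \<longleftrightarrow> (a, t) \<in> set xs"

fun tree_diverges :: "'a sync_tree \<Rightarrow> bool" where
  "tree_diverges (ST xs b) \<longleftrightarrow> b"

definition tree_sys :: "('a sync_tree, 'a) trans_sys" where
  "tree_sys = \<lparr>step = tree_step, diverges = tree_diverges\<rparr>"

definition sum_sys ::
  "('p, 'a) trans_sys \<Rightarrow> ('q, 'a) trans_sys \<Rightarrow> ('p + 'q, 'a) trans_sys" where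
  "sum_sys S T =
    \<lparr>step = (\<lambda>x a y.
        (\<exists>p p'. x = Inl p \<and> y = Inl p' \<and> step S p a p') \<or>
        (\<exists>q q'. x = Inr q \<and> y = Inr q' \<and> step T q a q')),
     diverges = case_sum (diverges S) (diverges T)\<rparr>"

definition pre_fin :: "('p, 'a) trans_sys \<Rightarrow> 'p \<Rightarrow> 'p \<Rightarrow> bool" where
  "pre_fin T p q \<longleftrightarrow>
    (\<forall>t. prebisim (sum_sys tree_sys T) (Inl t) (Inr p) \<longrightarrow>
         prebisim (sum_sys tree_sys T) (Inl t) (Inr q))"


text \<open>
  The types \<open>'a pform\<close> and \<open>'a kform\<close> are the formulas of sort \<open>\<pi>\<close>
  and \<open>\<kappa>\<close> of the finitary language; a finite family of formulas is a list.
\<close>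

datatype 'a pform =
    PConj "'a pform list"
  | PDisj "'a pform list"
  | Box "'a kform"
  | Dia "'a kform"
and 'a kform =
    KConj "'a kform list"
  | KDisj "'a kform list"
  | Act 'a "'a pform"

datatype ('p, 'a) capability = Bottom | Cap 'a 'p

definition capabilities :: "('p, 'a) trans_sys \<Rightarrow> 'p \<Rightarrow> ('p, 'a) capability set" where
  "capabilities T p = {c. c = Bottom \<and> diverges T p} \<union> {Cap a q | a q. step T p a q}"

text \<open>
  The proper class of infinitary formulas, with conjunctions and disjunctions over
  arbitrary sets, is not a type.  Its connectives are therefore given as operations on
  satisfaction predicates: \<open>box\<close>, \<open>dia\<close>, \<open>act\<close>, and the lattice
  operations \<open>INF\<close> and \<open>SUP\<close> on predicates for conjunction and disjunction.
  The order on predicates is pointwise implication, i.e. validity of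
  \<open>\<phi> \<le> \<psi>\<close> in the transition system.
\<close>

definition box ::
  "('p, 'a) trans_sys \<Rightarrow> (('p, 'a) capability \<Rightarrow> bool) \<Rightarrow> 'p \<Rightarrow> bool" where
  "box T P p \<longleftrightarrow> (\<forall>c \<in> capabilities T p. P c)"

definition dia ::
  "('p, 'a) trans_sys \<Rightarrow> (('p, 'a) capability \<Rightarrow> bool) \<Rightarrow> 'p \<Rightarrow> bool" where
  "dia T P p \<longleftrightarrow> (\<exists>c \<in> capabilities T p \<union> {Bottom}. P c)"

definition act :: "'a \<Rightarrow> ('p \<Rightarrow> bool) \<Rightarrow> ('p, 'a) capability \<Rightarrow> bool" where
  "act a P c \<longleftrightarrow> (\<exists>q. c = Cap a q \<and> P q)"

fun psat :: "('p, 'a) trans_sys \<Rightarrow> 'a pform \<Rightarrow> 'p \<Rightarrow> bool"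
and ksat :: "('p, 'a) trans_sys \<Rightarrow> 'a kform \<Rightarrow> ('p, 'a) capability \<Rightarrow> bool" where
  "psat T (PConj \<phi>s) = (INF \<phi> \<in> set \<phi>s. psat T \<phi>)"
| "psat T (PDisj \<phi>s) = (SUP \<phi> \<in> set \<phi>s. psat T \<phi>)"
| "psat T (Box \<phi>) = box T (ksat T \<phi>)"
| "psat T (Dia \<phi>) = dia T (ksat T \<phi>)"
| "ksat T (KConj \<phi>s) = (INF \<phi> \<in> set \<phi>s. ksat T \<phi>)"
| "ksat T (KDisj \<phi>s) = (SUP \<phi> \<in> set \<phi>s. ksat T \<phi>)"
| "ksat T (Act a \<phi>) = act a (psat T \<phi>)"

definition Lomega :: "('p, 'a) trans_sys \<Rightarrow> 'p \<Rightarrow> 'a pform set" where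
  "Lomega T p = {\<phi>. psat T \<phi> p}"

definition Fin :: "'i set \<Rightarrow> 'i set set" where
  "Fin I = {J. J \<subseteq> I \<and> finite J}"

definition BN :: "('p, 'a) trans_sys \<Rightarrow> 'i set \<Rightarrow> ('i \<Rightarrow> 'a kform) \<Rightarrow> bool" where
  "BN T I \<phi> \<longleftrightarrow>
    box T (SUP i \<in> I. ksat T (\<phi> i)) \<le> (SUP J \<in> Fin I. box T (SUP j \<in> J. ksat T (\<phi> j)))"

definition FA :: "('p, 'a) trans_sys \<Rightarrow> 'i set \<Rightarrow> ('i \<Rightarrow> 'a kform) \<Rightarrow> bool" where
  "FA T I \<phi> \<longleftrightarrow>
    (INF J \<in> Fin I. dia T (INF j \<in> J. ksat T (\<phi> j))) \<le> dia T (INF i \<in> I. ksat T (\<phi> i))"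

text \<open>
  A definition cannot quantify over index sets of all types.  Index sets
  consisting of formulas are enough, since every family has the same members as a family
  indexed by its own range; see \<open>finitary_family\<close> below.
\<close>

definition finitary :: "('p, 'a) trans_sys \<Rightarrow> bool" where
  "finitary T \<longleftrightarrow> (\<forall>(I :: 'a kform set) (\<phi> :: 'a kform \<Rightarrow> 'a kform). BN T I \<phi> \<and> FA T I \<phi>)"

lemma Fin_image: "Fin (f ` I) = (\<lambda>J. f ` J) ` Fin I"
  by (auto simp: Fin_def image_iff dest: finite_subset_image)

lemma finitary_family:
  fixes I :: "'i set" and \<phi> :: "'i \<Rightarrow> 'a kform"
  assumes "finitary T"
  shows "BN T I \<phi>" and "FA T I \<phi>"
proof -
  have "BN T (\<phi> ` I) (\<lambda>\<psi>. \<psi>)" and "FA T (\<phi> ` I) (\<lambda>\<psi>. \<psi>)"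
    using assms by (auto simp: finitary_def)
  then show "BN T I \<phi>" and "FA T I \<phi>"
    by (simp_all add: BN_def FA_def Fin_image image_image)
qed

end

theory Submission
  imports Defs
begin

text \<open>
  Over a finitary system the inclusion of theories is itself a prebisimulation: \<open>FA\<close> realises
  the whole theory of a successor at a single successor, and \<open>BN\<close> cuts the infinite disjunction
  of formulas separating the successors of \<open>p\<close> from one of \<open>q\<close> down to a finite one.  Finite
  trees enter through their characteristic formulas, \<open>t \<lesssim>\<^sup>B p \<longleftrightarrow> p \<Turnstile> \<chi>\<^sub>t\<close>: every satisfied formula
  is implied by some satisfied characteristic formula, where \<open>BN\<close> again selects finitely many
  of the approximations of the successors.
\<close>

section \<open>Capabilities, satisfaction and the approximants of prebisimulation\<close>

lemma box_capabilities:
  "box T P p \<longleftrightarrow> (diverges T p \<longrightarrow> P Bottom) \<and> (\<forall>a p'. step T p a p' \<longrightarrow> P (Cap a p'))"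
  by (auto simp: box_def capabilities_def)

lemma dia_capabilities:
  "dia T P p \<longleftrightarrow> P Bottom \<or> (\<exists>a p'. step T p a p' \<and> P (Cap a p'))"
  by (auto simp: dia_def capabilities_def)

lemma act_simps [simp]:
  "act a P Bottom \<longleftrightarrow> False"
  "act a P (Cap b q) \<longleftrightarrow> a = b \<and> P q"
  by (auto simp: act_def)

text \<open>\<open>Act\<close> fails at \<open>Bottom\<close> and the other connectives of this sort
  are monotone, so truth at \<open>Bottom\<close> cannot depend on the capability. At a divergent
  state this makes every true \<open>Box \<phi>\<close> trivial: \<open>\<phi>\<close> holds at
  \<open>Bottom\<close>, hence everywhere.\<close>

lemma ksat_Bottom_imp: "ksat T \<phi> Bottom \<Longrightarrow> ksat T \<phi> c"
  by (induction T \<phi> rule: psat_ksat.induct(2)[where P = "\<lambda>_ _. True"]) auto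

lemma prebisim_unfold: "prebisim T = pre_step T (prebisim T)"
  unfolding prebisim_def by (rule gfp_unfold[OF mono_pre_step])

lemma prebisim_imp_pre_omega:
  assumes "prebisim T p q"
  shows "pre_omega T p q"
proof -
  have "prebisim T \<le> pre_approx T n" for n
  proof (induction n)
    case (Suc n)
    then have "pre_step T (prebisim T) \<le> pre_step T (pre_approx T n)"
      by (rule monoD[OF mono_pre_step])
    then show ?case by (simp flip: prebisim_unfold)
  qed auto
  with assms show ?thesis by (auto simp: pre_omega_def)
qed

lemma size_mem_list: "x \<in> set xs \<Longrightarrow> size x \<le> size_list size xs"
  by (simp add: size_list_estimation')

text \<open>The size of a formula serves as a bound on its modal depth.\<close>

lemma sat_pre_approx:
  "\<lbrakk>size \<phi> \<le> n; pre_approx T n p q; psat T \<phi> p\<rbrakk> \<Longrightarrow> psat T \<phi> q"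
  "\<lbrakk>size \<psi> \<le> n; pre_approx T n p q; ksat T \<psi> (Cap a p)\<rbrakk> \<Longrightarrow> ksat T \<psi> (Cap a q)"
proof (induction T \<phi> and T \<psi> arbitrary: n p q and n p q a rule: psat_ksat.induct)
  case (1 T \<phi>s)
  then show ?case by simp (meson Suc_leD le_trans size_mem_list)
next
  case (2 T \<phi>s)
  then show ?case by simp (meson Suc_leD le_trans size_mem_list)
next
  case (3 T \<phi>)
  \<comment> \<open>\<open>Box\<close> adds one to the size, so \<open>n\<close> is a successor;
    this unit pays for one unfolding of \<open>pre_approx\<close>.\<close>
  then obtain m where m: "n = Suc m" "size \<phi> \<le> m" by (cases n) auto
  show ?case
  proof (cases "diverges T p")
    case True
    then have "ksat T \<phi> Bottom" using 3 by (simp add: box_capabilities)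
    then show ?thesis by (simp add: box_def ksat_Bottom_imp)
  next
    case False
    with 3 m show ?thesis by (fastforce simp: box_capabilities pre_step_def)
  qed
next
  case (4 T \<phi>)
  then obtain m where m: "n = Suc m" "size \<phi> \<le> m" by (cases n) auto
  with 4 show ?case by (fastforce simp: dia_capabilities pre_step_def)
next
  case (5 T \<phi>s)
  then show ?case by simp (meson Suc_leD le_trans size_mem_list)
next
  case (6 T \<phi>s)
  then show ?case by simp (meson Suc_leD le_trans size_mem_list)
next
  case (7 T a \<phi>)
  then show ?case by (auto dest: Suc_leD)
qed

lemma pre_omega_imp_Lomega: "pre_omega T p q \<Longrightarrow> Lomega T p \<subseteq> Lomega T q"
  by (auto simp: pre_omega_def Lomega_def intro: sat_pre_approx(1)[OF order_refl])

section \<open>Inclusion of theories is a prebisimulation\<close>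

lemma finitary_box:
  assumes "finitary T" "\<not> diverges T p"
    and cover: "\<And>a p'. step T p a p' \<Longrightarrow> \<exists>i\<in>I. ksat T (\<phi> i) (Cap a p')"
  obtains xs where "set xs \<subseteq> I" "psat T (Box (KDisj (map \<phi> xs))) p"
proof -
  \<comment> \<open>Convergence removes \<open>Bottom\<close> from the capabilities of
    \<open>p\<close>, so covering the successors covers them all.\<close>
  have "box T (SUP i\<in>I. ksat T (\<phi> i)) p"
    using assms by (auto simp: box_capabilities)
  with finitary_family(1)[OF assms(1), of I \<phi>]
  obtain J where "J \<subseteq> I" "finite J" "box T (SUP j\<in>J. ksat T (\<phi> j)) p"
    by (auto simp: BN_def Fin_def le_fun_def)
  \<comment> \<open>Listing the finite index set turns the disjunction into an actual formula, which
    can be carried to other states.\<close>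
  moreover obtain xs where "set xs = J" using finite_list[OF \<open>finite J\<close>] by blast
  ultimately show thesis using that[of xs] by (simp add: image_image)
qed

text \<open>\<open>FA\<close> with premises that are genuine formulas, hence available at
  \<open>q\<close> once they hold at \<open>p\<close>, and with an infinitary conclusion: one
  capability meets the whole family.\<close>

lemma finitary_dia:
  assumes "finitary T"
    and "\<And>xs. set xs \<subseteq> I \<Longrightarrow> psat T (Dia (KConj (map \<phi> xs))) p"
  shows "dia T (\<lambda>c. \<forall>i\<in>I. ksat T (\<phi> i) c) p"
proof -
  have "dia T (INF j\<in>J. ksat T (\<phi> j)) p" if J: "J \<in> Fin I" for J
  proof -
    obtain xs where "set xs = J" using J finite_list[of J] by (auto simp: Fin_def)
    then show ?thesis using assms(2)[of xs] J by (simp add: Fin_def image_image)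
  qed
  with finitary_family(2)[OF assms(1), of I \<phi>]
  have "dia T (INF i\<in>I. ksat T (\<phi> i)) p"
    by (auto simp: FA_def le_fun_def)
  then show ?thesis by (simp add: dia_def)
qed

lemma Lomega_imp_prebisim:
  assumes fin: "finitary T" and pq: "Lomega T p \<subseteq> Lomega T q"
  shows "prebisim T p q"
proof -
  let ?R = "\<lambda>p q. Lomega T p \<subseteq> Lomega T q"
  \<comment> \<open>Truth belongs to every theory. A theory is therefore nonempty, which keeps
    \<open>Bottom\<close> and capabilities with another action from satisfying all its formulas
    under \<open>Act a\<close>.\<close>
  have tt: "psat T (PConj []) r" for r by simp
  have "pre_step T ?R p q" if pq: "?R p q" for p q
  proof -
    have sat: "psat T \<phi> p \<Longrightarrow> psat T \<phi> q" for \<phi> using pq by (auto simp: Lomega_def)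
    have forth: "\<exists>q'. step T q a q' \<and> ?R p' q'" if "step T p a p'" for a p'
    proof -
      have "psat T (Dia (KConj (map (Act a) xs))) p" if "set xs \<subseteq> Lomega T p'" for xs
        using that \<open>step T p a p'\<close> by (fastforce simp: dia_capabilities Lomega_def)
      then have "dia T (\<lambda>c. \<forall>\<phi>\<in>Lomega T p'. ksat T (Act a \<phi>) c) q"
        by (intro finitary_dia[OF fin] sat)
      then show ?thesis using tt[of p']
        by (auto simp: dia_capabilities Lomega_def simp del: psat.simps)
    qed
    have conv: "\<not> diverges T q" if p: "\<not> diverges T p"
    proof -
      \<comment> \<open>The formula says that each capability is a transition with one of finitely
        many actions. No disjunct holds at \<open>Bottom\<close>, so the formula forces convergence
        at \<open>q\<close>.\<close>
      obtain xs where "psat T (Box (KDisj (map (\<lambda>a. Act a (PConj [])) xs))) p"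
        using finitary_box[OF fin p, of UNIV "\<lambda>a. Act a (PConj [])"] by auto
      from sat[OF this] show ?thesis by (auto simp: box_capabilities)
    qed
    have backward: "\<exists>p'. step T p a p' \<and> ?R p' q'"
      if p: "\<not> diverges T p" and "step T q a q'" for a q'
    proof (rule ccontr)
      assume neg: "\<not> ?thesis"
      \<comment> \<open>The pairs whose formula \<open>Act b \<phi>\<close> fails at the capability
        \<open>Cap a q'\<close>. Every successor of \<open>p\<close> satisfies some of them: a
        separating formula if its action is \<open>a\<close>, and truth under its own action
        otherwise.\<close>
      let ?I = "{(b, \<phi>). b = a \<longrightarrow> \<not> psat T \<phi> q'}"
      have "\<exists>i\<in>?I. ksat T (case i of (b, \<phi>) \<Rightarrow> Act b \<phi>) (Cap b p')" if "step T p b p'" for b p'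
      proof (cases "b = a")
        case True
        then obtain \<phi> where "psat T \<phi> p'" "\<not> psat T \<phi> q'"
          using neg \<open>step T p b p'\<close> by (auto simp: Lomega_def)
        with True show ?thesis by auto
      next
        case False
        with tt[of p'] show ?thesis by (intro bexI[of _ "(b, PConj [])"]) auto
      qed
      then obtain xs where "set xs \<subseteq> ?I" "psat T (Box (KDisj (map (\<lambda>(b, \<phi>). Act b \<phi>) xs))) p"
        using finitary_box[OF fin p, of ?I "\<lambda>(b, \<phi>). Act b \<phi>"] by auto
      with sat[OF this(2)] \<open>step T q a q'\<close> show False
        by (fastforce simp: box_capabilities)
    qed
    show ?thesis using forth conv backward by (auto simp: pre_step_def)
  qed
  then have "?R \<le> pre_step T ?R" by (auto simp: le_fun_def)
  from prebisim_largest(2)[OF this] pq show ?thesis by (auto simp: le_fun_def)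
qed

section \<open>Characteristic formulas of finite trees\<close>

fun char_form :: "'a sync_tree \<Rightarrow> 'a pform" where
  "char_form (ST xs b) =
    PConj ((if b then [] else [Box (KDisj (map (\<lambda>(a, t). Act a (char_form t)) xs))]) @
           map (\<lambda>(a, t). Dia (Act a (char_form t))) xs)"

text \<open>The diamonds give the first clause of prebisimulation. The box conjunct, present only
  without \<open>\<Omega>\<close>, gives the second, convergence included, because none of its
  disjuncts holds at \<open>Bottom\<close>.\<close>

lemma psat_char_form:
  "psat T (char_form (ST xs b)) p \<longleftrightarrow>
    (\<forall>(a, t) \<in> set xs. \<exists>p'. step T p a p' \<and> psat T (char_form t) p') \<and>
    (\<not> b \<longrightarrow> \<not> diverges T p \<and>
      (\<forall>a p'. step T p a p' \<longrightarrow> (\<exists>t. (a, t) \<in> set xs \<and> psat T (char_form t) p')))"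
  by (cases b; simp add: box_capabilities dia_capabilities case_prod_unfold;
      auto simp: Ball_def Bex_def)

text \<open>The shape matches \<open>psat_char_form\<close> clause by clause, with
  \<open>R (Inl t) (Inr p')\<close> for satisfaction of the characteristic formula.\<close>

lemma pre_step_sum_Inl_Inr:
  "pre_step (sum_sys tree_sys T) R (Inl (ST xs b)) (Inr p) \<longleftrightarrow>
    (\<forall>(a, t) \<in> set xs. \<exists>p'. step T p a p' \<and> R (Inl t) (Inr p')) \<and>
    (\<not> b \<longrightarrow> \<not> diverges T p \<and>
      (\<forall>a p'. step T p a p' \<longrightarrow> (\<exists>t. (a, t) \<in> set xs \<and> R (Inl t) (Inr p'))))"
  by (fastforce simp: pre_step_def sum_sys_def tree_sys_def)

text \<open>One direction is induction on the finite tree; the other is coinduction, satisfaction of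
  characteristic formulas being closed under \<open>pre_step\<close>.\<close>

lemma prebisim_tree_iff:
  "prebisim (sum_sys tree_sys T) (Inl t) (Inr p) \<longleftrightarrow> psat T (char_form t) p"
proof
  show "psat T (char_form t) p" if "prebisim (sum_sys tree_sys T) (Inl t) (Inr p)"
    using that
  proof (induction t arbitrary: p)
    case (ST xs b)
    have "pre_step (sum_sys tree_sys T) (prebisim (sum_sys tree_sys T)) (Inl (ST xs b)) (Inr p)"
      using ST.prems by (simp flip: prebisim_unfold)
    then show ?case
      unfolding psat_char_form pre_step_sum_Inl_Inr using ST.IH by fastforce
  qed
  let ?R = "\<lambda>x y. \<exists>t p. x = Inl t \<and> y = Inr p \<and> psat T (char_form t) p"
  have "pre_step (sum_sys tree_sys T) ?R (Inl t) (Inr p)" if "psat T (char_form t) p" for t p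
    using that by (cases t) (simp add: pre_step_sum_Inl_Inr psat_char_form del: char_form.simps)
  then have "?R \<le> pre_step (sum_sys tree_sys T) ?R" by (auto simp: le_fun_def)
  from prebisim_largest(2)[OF this]
  show "psat T (char_form t) p \<Longrightarrow> prebisim (sum_sys tree_sys T) (Inl t) (Inr p)"
    by (auto simp: le_fun_def)
qed

lemma pre_fin_iff:
  "pre_fin T p q \<longleftrightarrow> (\<forall>t. psat T (char_form t) p \<longrightarrow> psat T (char_form t) q)"
  by (simp add: pre_fin_def prebisim_tree_iff)

section \<open>Approximating a state by a finite tree\<close>

fun modal_args :: "'a pform \<Rightarrow> 'a kform set" where
  "modal_args (PConj \<phi>s) = (\<Union>\<phi>\<in>set \<phi>s. modal_args \<phi>)"
| "modal_args (PDisj \<phi>s) = (\<Union>\<phi>\<in>set \<phi>s. modal_args \<phi>)"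
| "modal_args (Box \<phi>) = {\<phi>}"
| "modal_args (Dia \<phi>) = {\<phi>}"

fun act_args :: "'a kform \<Rightarrow> 'a pform set" where
  "act_args (KConj \<phi>s) = (\<Union>\<phi>\<in>set \<phi>s. act_args \<phi>)"
| "act_args (KDisj \<phi>s) = (\<Union>\<phi>\<in>set \<phi>s. act_args \<phi>)"
| "act_args (Act a \<phi>) = {\<phi>}"

lemma finite_modal_args: "finite (modal_args \<phi>)"
  by (induction \<phi> rule: modal_args.induct) auto

lemma finite_act_args: "finite (act_args \<phi>)"
  by (induction \<phi> rule: act_args.induct) auto

lemma size_modal_args: "\<psi> \<in> modal_args \<phi> \<Longrightarrow> size \<psi> < size \<phi>"
  by (induction \<phi> rule: modal_args.induct) (fastforce dest: size_mem_list)+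

lemma size_act_args: "\<psi> \<in> act_args \<phi> \<Longrightarrow> size \<psi> < size \<phi>"
  by (induction \<phi> rule: act_args.induct) (fastforce dest: size_mem_list)+

lemma ksat_transfer:
  assumes "\<And>\<psi>. \<psi> \<in> act_args \<phi> \<Longrightarrow> psat T \<psi> p \<Longrightarrow> psat T \<psi> q"
    and "ksat T \<phi> (Cap a p)"
  shows "ksat T \<phi> (Cap a q)"
  using assms by (induction \<phi> rule: act_args.induct) (simp; blast)+

text \<open>A formula is a monotone combination of its outermost boxes and diamonds.
  \<open>modal_args\<close> forgets which modality stood above an argument, so both are assumed to
  transfer.\<close>

lemma psat_transfer:
  assumes "\<And>\<psi>. \<psi> \<in> modal_args \<phi> \<Longrightarrow> psat T (Box \<psi>) p \<Longrightarrow> psat T (Box \<psi>) q"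
    and "\<And>\<psi>. \<psi> \<in> modal_args \<phi> \<Longrightarrow> psat T (Dia \<psi>) p \<Longrightarrow> psat T (Dia \<psi>) q"
    and "psat T \<phi> p"
  shows "psat T \<phi> q"
  using assms by (induction \<phi> rule: modal_args.induct) (simp; blast)+

text \<open>
  All formulas of a finite set are treated at once, since the approximating trees obtained for
  the conjuncts of a conjunction one by one would have to be joined below \<open>p\<close>.
\<close>

lemma finitary_approximating_tree:
  fixes T :: "('p, 'a) trans_sys"
  assumes fin: "finitary T"
  shows "\<lbrakk>finite S; \<And>\<phi>. \<phi> \<in> S \<Longrightarrow> size \<phi> < n\<rbrakk> \<Longrightarrow>
    \<exists>t. psat T (char_form t) p \<and>
      (\<forall>\<phi>\<in>S. psat T \<phi> p \<longrightarrow> (\<forall>q. psat T (char_form t) q \<longrightarrow> psat T \<phi> q))"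
proof (induction n arbitrary: S p)
  case 0
  \<comment> \<open>The tree \<open>\<Omega>\<close> lies below every state, and no formula has size
    below 0, so \<open>S\<close> is empty.\<close>
  have "psat T (char_form (ST [] True)) p" by simp
  with 0 show ?case by blast
next
  case (Suc n)
  \<comment> \<open>One modality and one action are stripped from all formulas of \<open>S\<close>
    together. Sizes drop, so the induction hypothesis gives every state \<open>r\<close> a tree
    \<open>f r\<close> that approximates it with respect to \<open>S'\<close>.\<close>
  define K where "K = (\<Union>\<phi>\<in>S. modal_args \<phi>)"
  define S' where "S' = (\<Union>\<psi>\<in>K. act_args \<psi>)"
  have finK: "finite K" using Suc.prems by (simp add: K_def finite_modal_args)
  then have "finite S'" by (simp add: S'_def finite_act_args)
  moreover have "size \<phi> < n" if "\<phi> \<in> S'" for \<phi>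
    using that Suc.prems(2) by (fastforce simp: S'_def K_def dest: size_modal_args size_act_args)
  ultimately have "\<forall>r. \<exists>t. psat T (char_form t) r \<and>
      (\<forall>\<phi>\<in>S'. psat T \<phi> r \<longrightarrow> (\<forall>q. psat T (char_form t) q \<longrightarrow> psat T \<phi> q))"
    using Suc.IH by blast
  then obtain f where f: "\<And>r. psat T (char_form (f r)) r"
    and f': "\<And>r \<phi> q. \<lbrakk>\<phi> \<in> S'; psat T \<phi> r; psat T (char_form (f r)) q\<rbrakk> \<Longrightarrow> psat T \<phi> q"
    by metis
  have transfer: "ksat T \<psi> (Cap a q)"
    if "\<psi> \<in> K" "ksat T \<psi> (Cap a r)" "psat T (char_form (f r)) q" for \<psi> a r q
  proof (rule ksat_transfer[OF _ that(2)])
    show "psat T \<phi> r \<Longrightarrow> psat T \<phi> q" if "\<phi> \<in> act_args \<psi>" for \<phi>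
      using f'[of \<phi> r q] that \<open>\<psi> \<in> K\<close> \<open>psat T (char_form (f r)) q\<close> by (auto simp: S'_def)
  qed
  \<comment> \<open>The possible summands, one for each transition of \<open>p\<close> and perhaps
    infinitely many. The tree takes finitely many: \<open>xs\<close> to cover all successors when
    \<open>p\<close> converges, \<open>ys\<close> to witness diamonds.\<close>
  define I where "I = {(a, f p') | a p'. step T p a p'}"
  have "\<exists>xs. set xs \<subseteq> I \<and> (\<not> diverges T p \<longrightarrow>
      psat T (Box (KDisj (map (\<lambda>(a, t). Act a (char_form t)) xs))) p)"
  proof (cases "diverges T p")
    case True
    then show ?thesis by (intro exI[of _ "[]"]) auto
  next
    case False
    have "\<exists>i\<in>I. ksat T (case i of (a, t) \<Rightarrow> Act a (char_form t)) (Cap a p')"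
      if "step T p a p'" for a p'
      using that f by (intro bexI[of _ "(a, f p')"]) (auto simp: I_def)
    then show ?thesis using finitary_box[OF fin False] by metis
  qed
  then obtain xs where xs: "set xs \<subseteq> I"
    and xs': "\<not> diverges T p \<Longrightarrow>
      psat T (Box (KDisj (map (\<lambda>(a, t). Act a (char_form t)) xs))) p"
    by blast
  \<comment> \<open>Diamonds whose argument holds at \<open>Bottom\<close> hold at every state, so
    only the others need a chosen transition of \<open>p\<close>.\<close>
  have "\<exists>a r. step T p a r \<and> ksat T \<psi> (Cap a r)"
    if "psat T (Dia \<psi>) p" "\<not> ksat T \<psi> Bottom" for \<psi>
    using that by (simp add: dia_capabilities)
  then obtain wa wr where w: "\<And>\<psi>. \<lbrakk>psat T (Dia \<psi>) p; \<not> ksat T \<psi> Bottom\<rbrakk> \<Longrightarrow>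
      step T p (wa \<psi>) (wr \<psi>) \<and> ksat T \<psi> (Cap (wa \<psi>) (wr \<psi>))"
    by metis
  define W where "W = (\<lambda>\<psi>. (wa \<psi>, f (wr \<psi>))) `
      {\<psi> \<in> K. psat T (Dia \<psi>) p \<and> \<not> ksat T \<psi> Bottom}"
  have "finite W" using finK by (simp add: W_def)
  then obtain ys where ys: "set ys = W" using finite_list by blast
  have "W \<subseteq> I" using w by (fastforce simp: W_def I_def)
  \<comment> \<open>Adding \<open>ys\<close> only weakens the box conjunct, and every summand comes
    from a transition of \<open>p\<close>, so \<open>p\<close> satisfies the characteristic formula
    of this tree.\<close>
  define t where "t = ST (xs @ ys) (diverges T p)"
  have sub: "set (xs @ ys) \<subseteq> I" using xs ys \<open>W \<subseteq> I\<close> by simp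
  have "psat T (char_form t) p"
    unfolding t_def psat_char_form
    using sub xs' f by (fastforce simp: I_def box_capabilities)
  moreover have "psat T \<phi> q"
    if "\<phi> \<in> S" "psat T \<phi> p" and q: "psat T (char_form t) q" for \<phi> q
  proof (rule psat_transfer[OF _ _ \<open>psat T \<phi> p\<close>])
    fix \<psi> assume "\<psi> \<in> modal_args \<phi>"
    with \<open>\<phi> \<in> S\<close> have K: "\<psi> \<in> K" by (auto simp: K_def)
    show "psat T (Box \<psi>) q" if box: "psat T (Box \<psi>) p"
    proof (cases "diverges T p")
      case True
      with box have "ksat T \<psi> Bottom" by (simp add: box_capabilities)
      then show ?thesis by (simp add: box_def ksat_Bottom_imp)
    next
      case False
      have "ksat T \<psi> (Cap a q')" if step: "step T q a q'" for a q'
      proof -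
        \<comment> \<open>The box conjunct matches \<open>q'\<close> with a summand, and
          \<open>I\<close> traces that summand back to a successor \<open>r\<close> of
          \<open>p\<close>, from which \<open>\<psi>\<close> transfers.\<close>
        obtain u where "(a, u) \<in> I" "psat T (char_form u) q'"
          using q step False sub unfolding t_def psat_char_form by blast
        then obtain r where "step T p a r" "psat T (char_form (f r)) q'"
          by (auto simp: I_def)
        moreover from this box have "ksat T \<psi> (Cap a r)" by (simp add: box_capabilities)
        ultimately show ?thesis using transfer[OF K] by blast
      qed
      moreover have "\<not> diverges T q"
        using q False unfolding t_def psat_char_form by blast
      ultimately show ?thesis by (simp add: box_capabilities)
    qed
    show "psat T (Dia \<psi>) q" if dia: "psat T (Dia \<psi>) p"
    proof (cases "ksat T \<psi> Bottom")
      case False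
      from w[OF dia False] have "ksat T \<psi> (Cap (wa \<psi>) (wr \<psi>))" by simp
      moreover have "(wa \<psi>, f (wr \<psi>)) \<in> set (xs @ ys)"
        using K dia False ys by (simp add: W_def)
      then obtain q' where "step T q (wa \<psi>) q'" "psat T (char_form (f (wr \<psi>))) q'"
        using q unfolding t_def psat_char_form by blast
      ultimately have "ksat T \<psi> (Cap (wa \<psi>) q')" using transfer[OF K] by blast
      with \<open>step T q (wa \<psi>) q'\<close> show ?thesis by (auto simp: dia_capabilities)
    qed (simp add: dia_capabilities)
  qed
  ultimately show ?case by blast
qed

lemma pre_fin_imp_Lomega:
  assumes "finitary T" "pre_fin T p q"
  shows "Lomega T p \<subseteq> Lomega T q"
proof
  fix \<phi> assume "\<phi> \<in> Lomega T p"
  moreover obtain t where "psat T (char_form t) p"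
    "psat T \<phi> p \<Longrightarrow> psat T (char_form t) q \<Longrightarrow> psat T \<phi> q"
    using finitary_approximating_tree[OF assms(1), of "{\<phi>}" "Suc (size \<phi>)" p] by auto
  ultimately show "\<phi> \<in> Lomega T q" using assms(2) by (auto simp: pre_fin_iff Lomega_def)
qed

theorem mainTheorem8:
  fixes T :: "('p, 'a) trans_sys" and p q :: 'p
  assumes "finitary T"
  shows "(prebisim T p q \<longleftrightarrow> pre_omega T p q) \<and>
         (pre_omega T p q \<longleftrightarrow> pre_fin T p q) \<and>
         (pre_fin T p q \<longleftrightarrow> Lomega T p \<subseteq> Lomega T q)"
proof -
  \<comment> \<open>Characteristic formulas are themselves formulas of the finitary
    language.\<close>
  have "pre_fin T p q" if "Lomega T p \<subseteq> Lomega T q"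
    using that by (auto simp: pre_fin_iff Lomega_def)
  then show ?thesis
    using prebisim_imp_pre_omega[of T p q] pre_omega_imp_Lomega[of T p q]
      Lomega_imp_prebisim[OF assms, of p q] pre_fin_imp_Lomega[OF assms, of p q] by blast
qed

end
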